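(* Let $d\geq 4$ be an integer. Assume $\Phi\subset\mathbb{S}^{d-1}$ is a Levenstein-equality packing with size $n$. Then either $n=\frac{d(d+2)}{2}$ or $$n\in\left\{\frac{d(d+2)(d-1+\alpha)}{3\alpha}:\ \alpha\in\Big[2,\frac{2(d-1)(d+2)}{d+5}\Big]\cap\mathbb{Z}\right\}\cap\mathbb{Z}.$$ In particular, if $n\notin\{\frac{d(d+2)}{2},\frac{d(d+1)(d+2)}{6}\}$, then $\frac{d(d+3)}{2}\leq n\leq \frac{d(d+2)^2}{9}$.
   Context: For a finite set $\Phi=\{\boldsymbol\varphi_i\}_{i=1}^n$ of unit vectors in $\mathbb{R}^d$, the coherence is $\mu(\Phi):=\max_{i\neq j}|\langle\boldsymbol\varphi_i,\boldsymbol\varphi_j\rangle|$. For $n>\frac{d(d+1)}{2}$ one always has $\mu(\Phi)\geq \sqrt{\frac{3n-d(d+2)}{(d+2)(n-d)}}$ (the Levenstein bound). A Levenstein-equality packing of size $n$ is such a set $\Phi\subset\mathbb{S}^{d-1}$ with $n>\frac{d(d+1)}{2}$ and $\mu(\Phi)=\sqrt{\frac{3n-d(d+2)}{(d+2)(n-d)}}$. *)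

theory Defs
  imports "HOL-Analysis.Analysis"
begin

text \<open>
  The coherence is only meaningful for finite sets with at least two elements; below it is
  only used for sets with more than \<open>d (d + 1) / 2\<close> elements.
\<close>

definition coherence :: "(real ^ 'd) set \<Rightarrow> real" where
  "coherence \<Phi> = Max {\<bar>x \<bullet> y\<bar> | x y. x \<in> \<Phi> \<and> y \<in> \<Phi> \<and> x \<noteq> y}"

definition levenstein_bound :: "nat \<Rightarrow> nat \<Rightarrow> real" where
  "levenstein_bound d n =
     sqrt ((3 * real n - real d * (real d + 2)) / ((real d + 2) * (real n - real d)))"

definition levenstein_equality_packing :: "nat \<Rightarrow> (real ^ 'd) set \<Rightarrow> bool" where
  "levenstein_equality_packing n \<Phi> \<longleftrightarrow>
     finite \<Phi> \<and> card \<Phi> = n \<and> \<Phi> \<subseteq> sphere 0 1 \<and>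
     real n > real CARD('d) * (real CARD('d) + 1) / 2 \<and>
     coherence \<Phi> = levenstein_bound CARD('d) n"

end

theory Submission
  imports Defs
begin

text \<open>
  Equality in the linear programming bound forces \<open>\<Phi>\<close> to be a projective 2-design (second and fourth
  moments as on the sphere) whose inner products satisfy \<open>t\<^sup>2 \<in> {0, B}\<close>, where
  \<open>B = \<mu>(\<Phi>)\<^sup>2\<close>. The fourth moments
  turn the relation "not orthogonal" into a strongly regular graph with non-principal eigenvalues
  \<open>- 1 / B\<close> and \<open>(2 n / (d (d + 2)) - 1) / B\<close>. Both are rational roots of a monic integer quadratic,
  hence integers. The first one makes \<open>\<alpha> = 3 / B - d - 2\<close> an integer, and solving for \<open>n\<close> gives the
  stated parametrization. The second one lies in \<open>(-1, 1)\<close> when \<open>n < d (d + 3) / 2\<close>, hence is 0 there,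
  which means \<open>n = d (d + 2) / 2\<close>. Finally \<open>\<alpha> \<ge> 2\<close> amounts to
  \<open>n \<le> d (d + 1) (d + 2) / 6\<close>, the dimension of the space of cubic forms.
\<close>

subsection \<open>Tensor powers and harmonic tensors\<close>

definition tensor :: "real ^ 'm \<Rightarrow> real ^ 'n \<Rightarrow> real ^ ('m \<times> 'n)" where
  "tensor x y = (\<chi> p. x $ fst p * y $ snd p)"

lemma inner_tensor: "tensor x y \<bullet> tensor u v = (x \<bullet> u) * (y \<bullet> v)"
  by (simp add: tensor_def inner_vec_def sum_product sum.cartesian_product case_prod_beta
        mult.commute mult.left_commute flip: UNIV_Times_UNIV)

definition tensor4 :: "real ^ 'd \<Rightarrow> real ^ (('d \<times> 'd) \<times> ('d \<times> 'd))" where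
  "tensor4 x = tensor (tensor x x) (tensor x x)"

lemma inner_tensor4: "tensor4 x \<bullet> tensor4 y = (x \<bullet> y) ^ 4"
  by (simp add: tensor4_def inner_tensor power4_eq_xxxx)

text \<open>
  The polarization identities behind these two tensors: \<open>dual_norm_quadratic x\<close> represents the
  quartic form \<open>u \<mapsto> (x \<bullet> u)\<^sup>2 * (u \<bullet> u)\<close>, and \<open>dual_norm_quartic\<close> the form \<open>u \<mapsto> (u \<bullet> u)\<^sup>2\<close>, as
  combinations of fourth powers of linear forms. All inner products with them then follow from
  \<open>inner_tensor4\<close>.
\<close>

definition dual_norm_quadratic :: "real ^ 'd \<Rightarrow> real ^ (('d \<times> 'd) \<times> ('d \<times> 'd))" where
  "dual_norm_quadratic x = (1 / 12) *\<^sub>R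
     ((\<Sum>b\<in>Basis. tensor4 (b + x) + tensor4 (b - x) - 2 *\<^sub>R tensor4 b)
      - (2 * real CARD('d)) *\<^sub>R tensor4 x)"

definition dual_norm_quartic :: "real ^ (('d::finite \<times> 'd) \<times> ('d \<times> 'd))" where
  "dual_norm_quartic = (\<Sum>b\<in>Basis. dual_norm_quadratic (b :: real ^ 'd))"

lemma sum_Basis_inner: "(\<Sum>b\<in>Basis. (b \<bullet> x) * (b \<bullet> y)) = x \<bullet> y" for x y :: "real ^ 'd"
  by (simp add: euclidean_inner[of x y] inner_commute)

lemma sum_Basis_inner_square: "(\<Sum>b\<in>Basis. (b \<bullet> x)\<^sup>2) = x \<bullet> x" for x :: "real ^ 'd"
  by (simp add: power2_eq_square sum_Basis_inner)

text \<open>The second difference of the fourth power in direction \<open>x\<close> yields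
  \<open>12 * (x \<bullet> y)\<^sup>2 * (b \<bullet> y)\<^sup>2\<close> plus a multiple of
  \<open>(x \<bullet> y) ^ 4\<close>. Summing over an orthonormal basis produces
  \<open>y \<bullet> y\<close>; the \<open>tensor4 x\<close> term of the definition cancels the
  surplus.\<close>

lemma inner_dual_norm_quadratic_tensor4:
  fixes x y :: "real ^ 'd"
  shows "dual_norm_quadratic x \<bullet> tensor4 y = (x \<bullet> y)\<^sup>2 * (y \<bullet> y)"
proof -
  have "(b \<bullet> y + x \<bullet> y) ^ 4 + (b \<bullet> y - x \<bullet> y) ^ 4 - 2 * (b \<bullet> y) ^ 4
      = 12 * (x \<bullet> y)\<^sup>2 * (b \<bullet> y)\<^sup>2 + 2 * (x \<bullet> y) ^ 4" for b :: "real ^ 'd"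
    by (simp add: power2_eq_square power4_eq_xxxx algebra_simps)
  then have "(\<Sum>b\<in>Basis. (b \<bullet> y + x \<bullet> y) ^ 4 + (b \<bullet> y - x \<bullet> y) ^ 4 - 2 * (b \<bullet> y) ^ 4)
      = 12 * (x \<bullet> y)\<^sup>2 * (y \<bullet> y) + 2 * real CARD('d) * (x \<bullet> y) ^ 4"
    by (simp add: sum.distrib flip: sum_distrib_left sum_Basis_inner_square)
  then show ?thesis
    by (simp add: dual_norm_quadratic_def inner_tensor4 inner_add_left inner_diff_left
        inner_sum_left algebra_simps)
qed

lemma inner_dual_norm_quadratic:
  fixes x y :: "real ^ 'd"
  shows "dual_norm_quadratic x \<bullet> dual_norm_quadratic y
    = ((x \<bullet> x) * (y \<bullet> y) + (real CARD('d) + 4) * (x \<bullet> y)\<^sup>2) / 6"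
proof -
  let ?f = "\<lambda>u. (x \<bullet> u)\<^sup>2 * (u \<bullet> u)"
  have "?f (b + y) + ?f (b - y) - 2 * ?f b
      = 2 * (y \<bullet> y) * (b \<bullet> x)\<^sup>2 + 8 * (x \<bullet> y) * ((b \<bullet> x) * (b \<bullet> y))
        + 2 * (x \<bullet> y)\<^sup>2 * (1 + y \<bullet> y)" if "b \<in> Basis" for b :: "real ^ 'd"
    using that
    by (simp add: inner_add_left inner_add_right inner_diff_left inner_diff_right
        inner_commute[of x b] inner_commute[of y b] inner_commute[of y x] power2_eq_square
        algebra_simps)
  then have "(\<Sum>b\<in>Basis. ?f (b + y) + ?f (b - y) - 2 * ?f b)
      = 2 * (y \<bullet> y) * (x \<bullet> x) + 8 * (x \<bullet> y) * (x \<bullet> y)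
        + real CARD('d) * (2 * (x \<bullet> y)\<^sup>2 * (1 + y \<bullet> y))"
    by (simp add: sum.distrib sum_Basis_inner sum_Basis_inner_square flip: sum_distrib_left)
  then show ?thesis
    by (simp add: dual_norm_quadratic_def[of y] inner_dual_norm_quadratic_tensor4 inner_add_right
        inner_diff_right inner_sum_right power2_eq_square algebra_simps)
qed

lemma inner_dual_norm_quartic_tensor4:
  "dual_norm_quartic \<bullet> tensor4 y = (y \<bullet> y)\<^sup>2"
  by (simp add: dual_norm_quartic_def inner_sum_left inner_dual_norm_quadratic_tensor4
      power2_eq_square sum_Basis_inner flip: sum_distrib_right)

lemma inner_dual_norm_quartic_quadratic:
  fixes y :: "real ^ 'd"
  shows "dual_norm_quartic \<bullet> dual_norm_quadratic y = (real CARD('d) + 2) / 3 * (y \<bullet> y)"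
proof -
  have "dual_norm_quartic \<bullet> dual_norm_quadratic y
      = (\<Sum>b\<in>Basis. (y \<bullet> y + (real CARD('d) + 4) * (b \<bullet> y)\<^sup>2) / 6)"
    by (simp add: dual_norm_quartic_def inner_sum_left inner_dual_norm_quadratic)
  also have "\<dots> = (real CARD('d) * (y \<bullet> y) + (real CARD('d) + 4) * (y \<bullet> y)) / 6"
    by (simp add: sum.distrib sum_Basis_inner_square flip: sum_divide_distrib sum_distrib_left)
  finally show ?thesis
    by (simp add: algebra_simps)
qed

lemma inner_dual_norm_quartic:
  "(dual_norm_quartic :: real ^ (('d::finite \<times> 'd) \<times> ('d \<times> 'd))) \<bullet> dual_norm_quartic
    = real CARD('d) * (real CARD('d) + 2) / 3"
  by (subst (2) dual_norm_quartic_def) (simp add: inner_sum_right inner_dual_norm_quartic_quadratic)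

text \<open>
  The coefficients are those of the monic Gegenbauer polynomial of degree 4 in dimension \<open>d\<close>, so that
  \<open>harmonic4 x\<close> is the projection of \<open>tensor4 x\<close> to the harmonic (traceless) tensors.
\<close>

definition harmonic4 :: "real ^ 'd \<Rightarrow> real ^ (('d \<times> 'd) \<times> ('d \<times> 'd))" where
  "harmonic4 x = tensor4 x - (6 / (real CARD('d) + 4)) *\<^sub>R dual_norm_quadratic x
     + (3 / ((real CARD('d) + 2) * (real CARD('d) + 4))) *\<^sub>R dual_norm_quartic"

lemma inner_harmonic4_tensor4:
  fixes x y :: "real ^ 'd"
  shows "harmonic4 x \<bullet> tensor4 y = (x \<bullet> y) ^ 4 - 6 / (real CARD('d) + 4) * ((x \<bullet> y)\<^sup>2 * (y \<bullet> y))
    + 3 / ((real CARD('d) + 2) * (real CARD('d) + 4)) * (y \<bullet> y)\<^sup>2"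
  by (simp add: harmonic4_def inner_add_left inner_diff_left inner_tensor4
      inner_dual_norm_quadratic_tensor4 inner_dual_norm_quartic_tensor4)

text \<open>The coefficients make \<open>harmonic4 x\<close> orthogonal to both trace parts of
  \<open>harmonic4 y\<close>, so only its pairing with \<open>tensor4 y\<close> survives.\<close>

lemma inner_harmonic4:
  fixes x y :: "real ^ 'd"
  assumes "x \<bullet> x = 1" and "y \<bullet> y = 1"
  shows "harmonic4 x \<bullet> harmonic4 y = (x \<bullet> y) ^ 4 - 6 / (real CARD('d) + 4) * (x \<bullet> y)\<^sup>2
    + 3 / ((real CARD('d) + 2) * (real CARD('d) + 4))"
proof -
  define d where "d = real CARD('d)"
  have d: "d > 0"
    by (simp add: d_def)
  have "dual_norm_quadratic y \<bullet> harmonic4 x = (x \<bullet> y)\<^sup>2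
      - 6 / (d + 4) * ((1 + (d + 4) * (x \<bullet> y)\<^sup>2) / 6) + 3 / ((d + 2) * (d + 4)) * ((d + 2) / 3)"
    using assms
    by (simp add: harmonic4_def inner_add_right inner_diff_right inner_dual_norm_quadratic
        inner_commute[of _ dual_norm_quartic] inner_dual_norm_quartic_quadratic
        inner_dual_norm_quadratic_tensor4 inner_commute[of y x] d_def)
  also have "\<dots> = 0"
    using d by (simp add: divide_simps) (simp add: algebra_simps)
  finally have "dual_norm_quadratic y \<bullet> harmonic4 x = 0" .
  moreover have "dual_norm_quartic \<bullet> harmonic4 x
      = 1 - 6 / (d + 4) * ((d + 2) / 3) + 3 / ((d + 2) * (d + 4)) * (d * (d + 2) / 3)"
    using assms
    by (simp add: harmonic4_def inner_add_right inner_diff_right inner_dual_norm_quartic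
        inner_dual_norm_quartic_tensor4 inner_dual_norm_quartic_quadratic d_def)
  then have "dual_norm_quartic \<bullet> harmonic4 x = 0"
    using d by (simp add: divide_simps)
  ultimately show ?thesis
    using assms
    by (simp add: harmonic4_def[of y] inner_add_right inner_diff_right inner_harmonic4_tensor4
        inner_commute[of "harmonic4 x"])
qed

subsection \<open>The equality case of the Levenstein bound\<close>

text \<open>The subtracted sum is the identity matrix; for a unit vector this is the traceless part
  of \<open>tensor x x\<close>.\<close>

definition harmonic2 :: "real ^ 'd \<Rightarrow> real ^ ('d \<times> 'd)" where
  "harmonic2 x = tensor x x - (1 / real CARD('d)) *\<^sub>R (\<Sum>b\<in>Basis. tensor b b)"

lemma inner_harmonic2_tensor:
  fixes x y :: "real ^ 'd"
  shows "harmonic2 x \<bullet> tensor y y = (x \<bullet> y)\<^sup>2 - (y \<bullet> y) / real CARD('d)"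
  by (simp add: harmonic2_def inner_diff_left inner_sum_left inner_tensor sum_Basis_inner
      power2_eq_square)

lemma inner_harmonic2:
  fixes x y :: "real ^ 'd"
  assumes "x \<bullet> x = 1" and "y \<bullet> y = 1"
  shows "harmonic2 x \<bullet> harmonic2 y = (x \<bullet> y)\<^sup>2 - 1 / real CARD('d)"
proof -
  have "harmonic2 x \<bullet> (\<Sum>b\<in>Basis. tensor b b) = (\<Sum>b\<in>Basis. (b \<bullet> x)\<^sup>2 - 1 / real CARD('d))"
    unfolding inner_sum_right by (rule sum.cong) (simp_all add: inner_harmonic2_tensor inner_commute)
  also have "\<dots> = 0"
    using assms by (simp add: sum_subtractf sum_Basis_inner_square)
  finally have "harmonic2 x \<bullet> (\<Sum>b\<in>Basis. tensor b b) = 0" .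
  then show ?thesis
    using assms by (simp add: harmonic2_def[of y] inner_diff_right inner_harmonic2_tensor)
qed

text \<open>
  The polynomial \<open>t\<^sup>2 * (t\<^sup>2 - B)\<close> is nonpositive on the off-diagonal inner products and has
  nonnegative coefficients in the Gegenbauer basis; the choice of \<open>B\<close> makes the resulting linear
  programming bound an equality, so every discarded term vanishes.
\<close>

lemma levenstein_equality_case:
  fixes \<Phi> :: "(real ^ 'd) set" and B :: real
  defines "d \<equiv> real CARD('d)" and "n \<equiv> real (card \<Phi>)"
  assumes fin: "finite \<Phi>" and unit: "\<And>x. x \<in> \<Phi> \<Longrightarrow> x \<bullet> x = 1"
    and le: "\<And>x y. x \<in> \<Phi> \<Longrightarrow> y \<in> \<Phi> \<Longrightarrow> x \<noteq> y \<Longrightarrow> (x \<bullet> y)\<^sup>2 \<le> B"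
    and B: "B * ((d + 2) * (n - d)) = 3 * n - d * (d + 2)" and B_less: "B < 6 / (d + 4)"
  shows "(\<Sum>x\<in>\<Phi>. harmonic2 x) = 0" and "(\<Sum>x\<in>\<Phi>. harmonic4 x) = 0"
    and "\<And>x y. x \<in> \<Phi> \<Longrightarrow> y \<in> \<Phi> \<Longrightarrow> x \<noteq> y \<Longrightarrow> (x \<bullet> y)\<^sup>2 = 0 \<or> (x \<bullet> y)\<^sup>2 = B"
proof -
  define S2 where "S2 = (\<Sum>x\<in>\<Phi>. harmonic2 x) \<bullet> (\<Sum>x\<in>\<Phi>. harmonic2 x)"
  define S4 where "S4 = (\<Sum>x\<in>\<Phi>. harmonic4 x) \<bullet> (\<Sum>x\<in>\<Phi>. harmonic4 x)"
  define E where "E = (\<Sum>x\<in>\<Phi>. \<Sum>y\<in>\<Phi> - {x}. (x \<bullet> y)\<^sup>2 * (B - (x \<bullet> y)\<^sup>2))"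
  define M2 where "M2 = (\<Sum>x\<in>\<Phi>. \<Sum>y\<in>\<Phi>. (x \<bullet> y)\<^sup>2)"
  define M4 where "M4 = (\<Sum>x\<in>\<Phi>. \<Sum>y\<in>\<Phi>. (x \<bullet> y) ^ 4)"
  have d: "d > 0"
    by (simp add: d_def)
  have "S2 = (\<Sum>x\<in>\<Phi>. \<Sum>y\<in>\<Phi>. (x \<bullet> y)\<^sup>2 - 1 / d)"
    unfolding S2_def inner_sum_left by (simp add: inner_sum_right inner_harmonic2 unit d_def)
  then have S2: "S2 = M2 - n\<^sup>2 / d"
    by (simp add: M2_def sum_subtractf n_def power2_eq_square)
  have "S4 = (\<Sum>x\<in>\<Phi>. \<Sum>y\<in>\<Phi>. (x \<bullet> y) ^ 4 - 6 / (d + 4) * (x \<bullet> y)\<^sup>2 + 3 / ((d + 2) * (d + 4)))"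
    unfolding S4_def inner_sum_left by (simp add: inner_sum_right inner_harmonic4 unit d_def)
  then have S4: "S4 = M4 - 6 / (d + 4) * M2 + 3 * n\<^sup>2 / ((d + 2) * (d + 4))"
    by (simp add: M2_def M4_def sum.distrib sum_subtractf n_def power2_eq_square
        flip: sum_distrib_left sum_divide_distrib)
  have "(\<Sum>y\<in>\<Phi>. B * (x \<bullet> y)\<^sup>2 - (x \<bullet> y) ^ 4)
      = B - 1 + (\<Sum>y\<in>\<Phi> - {x}. (x \<bullet> y)\<^sup>2 * (B - (x \<bullet> y)\<^sup>2))" if "x \<in> \<Phi>" for x
    using that by (simp add: sum.remove[OF fin that] unit algebra_simps flip: power_add)
  then have "B * M2 - M4 = n * (B - 1) + E"
    by (simp add: M2_def M4_def E_def sum_distrib_left sum.distrib n_def flip: sum_subtractf)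
  \<comment> \<open>The constant Gegenbauer coefficient of \<open>t ^ 4 - B * t\<^sup>2\<close>,
    times \<open>n\<^sup>2\<close>, equals the diagonal contribution. This is where the value of
    \<open>B\<close> enters.\<close>
  moreover have "(6 / (d + 4) - B) * (n\<^sup>2 / d) - 3 * n\<^sup>2 / ((d + 2) * (d + 4)) = n * (1 - B)"
  proof -
    have "(6 / (d + 4) - B) * (n\<^sup>2 / d) - 3 * n\<^sup>2 / ((d + 2) * (d + 4))
        = n * (n * (3 - B * (d + 2)) / (d * (d + 2)))"
      using d by (simp add: divide_simps power2_eq_square) (simp add: algebra_simps)
    also have "n * (3 - B * (d + 2)) = (1 - B) * (d * (d + 2))"
      using B by (simp add: algebra_simps)
    finally show ?thesis
      using d by simp
  qed
  moreover have "S4 + (6 / (d + 4) - B) * S2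
      = M4 - B * M2 - ((6 / (d + 4) - B) * (n\<^sup>2 / d) - 3 * n\<^sup>2 / ((d + 2) * (d + 4)))"
    unfolding S2 S4 left_diff_distrib right_diff_distrib by linarith
  ultimately have "S4 + (6 / (d + 4) - B) * S2 + E = 0"
    by (simp add: algebra_simps)
  moreover have E_nonneg: "(x \<bullet> y)\<^sup>2 * (B - (x \<bullet> y)\<^sup>2) \<ge> 0"
    if "x \<in> \<Phi>" "y \<in> \<Phi> - {x}" for x y
    using le[of x y] that by auto
  then have "E \<ge> 0"
    by (auto simp: E_def intro!: sum_nonneg)
  moreover have "S2 \<ge> 0" "S4 \<ge> 0"
    by (simp_all add: S2_def S4_def)
  ultimately have zero: "S4 = 0" "(6 / (d + 4) - B) * S2 = 0" "E = 0"
    using B_less mult_nonneg_nonneg[of "6 / (d + 4) - B" S2] by linarith+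
  show "(\<Sum>x\<in>\<Phi>. harmonic2 x) = 0" "(\<Sum>x\<in>\<Phi>. harmonic4 x) = 0"
    using zero B_less by (simp_all add: S2_def S4_def)
  show "(x \<bullet> y)\<^sup>2 = 0 \<or> (x \<bullet> y)\<^sup>2 = B" if "x \<in> \<Phi>" "y \<in> \<Phi>" "x \<noteq> y" for x y
  proof -
    have "(\<Sum>y\<in>\<Phi> - {x}. (x \<bullet> y)\<^sup>2 * (B - (x \<bullet> y)\<^sup>2)) = 0"
      using that(1) zero(3) fin E_nonneg sum_nonneg_eq_0_iff[of \<Phi>
          "\<lambda>x. \<Sum>y\<in>\<Phi> - {x}. (x \<bullet> y)\<^sup>2 * (B - (x \<bullet> y)\<^sup>2)"]
      unfolding E_def by (meson sum_nonneg)
    then have "(x \<bullet> y)\<^sup>2 * (B - (x \<bullet> y)\<^sup>2) = 0"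
      using that fin E_nonneg sum_nonneg_eq_0_iff[of "\<Phi> - {x}"
          "\<lambda>y. (x \<bullet> y)\<^sup>2 * (B - (x \<bullet> y)\<^sup>2)"]
      by blast
    then show ?thesis
      by auto
  qed
qed

section \<open>Moments of projective designs\<close>

lemma design2_moment:
  fixes \<Phi> :: "(real ^ 'd) set"
  assumes "(\<Sum>x\<in>\<Phi>. harmonic2 x) = 0"
  shows "(\<Sum>z\<in>\<Phi>. (z \<bullet> x)\<^sup>2) = real (card \<Phi>) / real CARD('d) * (x \<bullet> x)"
proof -
  have "(\<Sum>z\<in>\<Phi>. (z \<bullet> x)\<^sup>2 - (x \<bullet> x) / real CARD('d)) = (\<Sum>z\<in>\<Phi>. harmonic2 z) \<bullet> tensor x x"
    by (simp add: inner_sum_left inner_harmonic2_tensor)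
  then show ?thesis
    using assms by (simp add: sum_subtractf)
qed

text \<open>Pairing the vanishing harmonic sum with \<open>tensor4 x\<close> gives the fourth moment
  for every vector \<open>x\<close>, not only unit ones; the polarization of the mixed moment relies
  on this.\<close>

lemma design4_moment:
  fixes \<Phi> :: "(real ^ 'd) set"
  assumes "(\<Sum>x\<in>\<Phi>. harmonic2 x) = 0" and "(\<Sum>x\<in>\<Phi>. harmonic4 x) = 0"
  shows "(\<Sum>z\<in>\<Phi>. (z \<bullet> x) ^ 4)
    = 3 * real (card \<Phi>) / (real CARD('d) * (real CARD('d) + 2)) * (x \<bullet> x)\<^sup>2"
proof -
  define d where "d = real CARD('d)"
  have d: "d > 0"
    by (simp add: d_def)
  have "(\<Sum>z\<in>\<Phi>. (z \<bullet> x) ^ 4 - 6 / (d + 4) * ((z \<bullet> x)\<^sup>2 * (x \<bullet> x))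
      + 3 / ((d + 2) * (d + 4)) * (x \<bullet> x)\<^sup>2) = (\<Sum>z\<in>\<Phi>. harmonic4 z) \<bullet> tensor4 x"
    by (simp add: inner_sum_left inner_harmonic4_tensor4 d_def)
  then have "(\<Sum>z\<in>\<Phi>. (z \<bullet> x) ^ 4) - 6 / (d + 4) * ((\<Sum>z\<in>\<Phi>. (z \<bullet> x)\<^sup>2) * (x \<bullet> x))
      + real (card \<Phi>) * (3 / ((d + 2) * (d + 4)) * (x \<bullet> x)\<^sup>2) = 0"
    using assms(2)
    by (simp add: sum.distrib sum_subtractf flip: sum_distrib_left sum_distrib_right sum_divide_distrib)
  then have "(\<Sum>z\<in>\<Phi>. (z \<bullet> x) ^ 4) = 6 / (d + 4) * (real (card \<Phi>) / d * (x \<bullet> x) * (x \<bullet> x))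
      - real (card \<Phi>) * (3 / ((d + 2) * (d + 4)) * (x \<bullet> x)\<^sup>2)"
    by (simp add: design2_moment[OF assms(1)] d_def)
  also have "\<dots> = 3 * real (card \<Phi>) / (d * (d + 2)) * (x \<bullet> x)\<^sup>2"
    using d by (simp add: divide_simps power2_eq_square) (auto simp: algebra_simps)
  finally show ?thesis
    by (simp add: d_def)
qed

text \<open>Polarization: \<open>(a + b) ^ 4 + (a - b) ^ 4 - 2 * a ^ 4 - 2 * b ^ 4 = 12 * a\<^sup>2
  * b\<^sup>2\<close>, applied with the fourth moments at \<open>x + y\<close>,
  \<open>x - y\<close>, \<open>x\<close> and \<open>y\<close>.\<close>

lemma design4_mixed_moment:
  fixes \<Phi> :: "(real ^ 'd) set"
  assumes "(\<Sum>x\<in>\<Phi>. harmonic2 x) = 0" and "(\<Sum>x\<in>\<Phi>. harmonic4 x) = 0"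
  shows "(\<Sum>z\<in>\<Phi>. (z \<bullet> x)\<^sup>2 * (z \<bullet> y)\<^sup>2)
    = real (card \<Phi>) / (real CARD('d) * (real CARD('d) + 2)) * ((x \<bullet> x) * (y \<bullet> y) + 2 * (x \<bullet> y)\<^sup>2)"
proof -
  define c where "c = real (card \<Phi>) / (real CARD('d) * (real CARD('d) + 2))"
  have moment: "(\<Sum>z\<in>\<Phi>. (z \<bullet> u) ^ 4) = 3 * c * (u \<bullet> u)\<^sup>2" for u
    by (simp add: design4_moment[OF assms] c_def)
  have "12 * (\<Sum>z\<in>\<Phi>. (z \<bullet> x)\<^sup>2 * (z \<bullet> y)\<^sup>2)
      = (\<Sum>z\<in>\<Phi>. (z \<bullet> (x + y)) ^ 4 + (z \<bullet> (x - y)) ^ 4 - 2 * (z \<bullet> x) ^ 4 - 2 * (z \<bullet> y) ^ 4)"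
    unfolding sum_distrib_left
    by (intro sum.cong refl)
      (simp add: inner_add_right inner_diff_right power2_eq_square power4_eq_xxxx algebra_simps)
  also have "\<dots> = (\<Sum>z\<in>\<Phi>. (z \<bullet> (x + y)) ^ 4) + (\<Sum>z\<in>\<Phi>. (z \<bullet> (x - y)) ^ 4)
      - 2 * (\<Sum>z\<in>\<Phi>. (z \<bullet> x) ^ 4) - 2 * (\<Sum>z\<in>\<Phi>. (z \<bullet> y) ^ 4)"
    by (simp add: sum.distrib sum_subtractf sum_distrib_left)
  also have "\<dots> = 3 * c * (((x + y) \<bullet> (x + y))\<^sup>2 + ((x - y) \<bullet> (x - y))\<^sup>2
      - 2 * (x \<bullet> x)\<^sup>2 - 2 * (y \<bullet> y)\<^sup>2)"
    by (simp only: moment) (simp add: algebra_simps)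
  also have "\<dots> = 12 * (c * ((x \<bullet> x) * (y \<bullet> y) + 2 * (x \<bullet> y)\<^sup>2))"
    by (simp add: inner_add_left inner_add_right inner_diff_left inner_diff_right
        inner_commute[of y x] power2_eq_square algebra_simps)
  finally show ?thesis
    by (simp add: c_def)
qed

subsection \<open>The absolute bound\<close>

text \<open>Pairing a linear relation among the \<open>v y\<close> with \<open>w x\<close> isolates
  the coefficient of \<open>v x\<close>, so the family is independent inside the span of
  \<open>T\<close>.\<close>

lemma card_le_if_biorthogonal:
  fixes v w :: "'a \<Rightarrow> 'b :: euclidean_space"
  assumes "finite S" and "finite T" and span: "v ` S \<subseteq> span T"
    and diag: "\<And>x. x \<in> S \<Longrightarrow> v x \<bullet> w x \<noteq> 0"
    and off_diag: "\<And>x y. x \<in> S \<Longrightarrow> y \<in> S \<Longrightarrow> x \<noteq> y \<Longrightarrow> v y \<bullet> w x = 0"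
  shows "card S \<le> card T"
proof -
  have inj: "inj_on v S"
    using diag off_diag by (metis inj_onI)
  have "independent (v ` S)"
  proof (rule independent_if_scalars_zero)
    fix f u
    assume f: "(\<Sum>u\<in>v ` S. f u *\<^sub>R u) = 0" and "u \<in> v ` S"
    then obtain x where x: "x \<in> S" "u = v x"
      by blast
    have "0 = (\<Sum>u\<in>v ` S. f u *\<^sub>R u) \<bullet> w x"
      using f by simp
    also have "\<dots> = (\<Sum>y\<in>S. f (v y) * (v y \<bullet> w x))"
      by (simp add: sum.reindex[OF inj] inner_sum_left)
    also have "\<dots> = (\<Sum>y\<in>S. if y = x then f (v x) * (v x \<bullet> w x) else 0)"
      by (rule sum.cong) (auto simp: off_diag x)
    also have "\<dots> = f u * (v x \<bullet> w x)"
      using x \<open>finite S\<close> by simp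
    finally show "f u = 0"
      using diag x by simp
  qed (use \<open>finite S\<close> in simp)
  then have "card (v ` S) \<le> card T"
    using independent_span_bound[OF \<open>finite T\<close>] span by blast
  then show ?thesis
    by (simp add: card_image inj)
qed

definition tensor3 :: "real ^ 'd \<Rightarrow> real ^ ('d \<times> ('d \<times> 'd))" where
  "tensor3 x = tensor x (tensor x x)"

definition symmetric_basis :: "'d :: finite multiset \<Rightarrow> real ^ ('d \<times> ('d \<times> 'd))" where
  "symmetric_basis M = (\<chi> p. if M = {#fst p, fst (snd p), snd (snd p)#} then 1 else 0)"

text \<open>An entry of \<open>tensor3 x\<close> depends only on the multiset of its three indices;
  the spanning set is therefore indexed by 3-element multisets.\<close>

lemma tensor3_in_span:
  fixes x :: "real ^ 'd"
  shows "tensor3 x \<in> span (symmetric_basis ` multisets_of_size UNIV 3)"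
proof -
  have "tensor3 x = (\<Sum>M\<in>multisets_of_size UNIV 3. (\<Prod>i\<in>#M. x $ i) *\<^sub>R symmetric_basis M)"
  proof (rule vec_eq_iff[THEN iffD2], rule allI)
    fix p :: "'d \<times> 'd \<times> 'd"
    have "{#fst p, fst (snd p), snd (snd p)#} \<in> multisets_of_size UNIV 3"
      by (simp add: multisets_of_size_def)
    then show "tensor3 x $ p
        = (\<Sum>M\<in>multisets_of_size UNIV 3. (\<Prod>i\<in>#M. x $ i) *\<^sub>R symmetric_basis M) $ p"
      by (simp add: symmetric_basis_def tensor3_def tensor_def if_distrib sum.delta
          finite_multisets_of_size cong: if_cong)
  qed
  then show ?thesis
    by (auto intro!: span_sum span_scale intro: span_base)
qed

text \<open>
  The cubics \<open>u \<mapsto> (x \<bullet> u) * ((x \<bullet> u)\<^sup>2 - B * (u \<bullet> u))\<close> are biorthogonal to the points of \<open>\<Phi>\<close>.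
\<close>

lemma absolute_bound:
  fixes \<Phi> :: "(real ^ 'd) set"
  assumes fin: "finite \<Phi>" and unit: "\<And>x. x \<in> \<Phi> \<Longrightarrow> x \<bullet> x = 1" and "B \<noteq> 1"
    and angle: "\<And>x y. x \<in> \<Phi> \<Longrightarrow> y \<in> \<Phi> \<Longrightarrow> x \<noteq> y \<Longrightarrow> (x \<bullet> y)\<^sup>2 = 0 \<or> (x \<bullet> y)\<^sup>2 = B"
  shows "card \<Phi> \<le> (CARD('d) + 2) choose 3"
proof -
  define w where "w x = tensor3 x - B *\<^sub>R (\<Sum>b\<in>Basis. tensor x (tensor b b))" for x :: "real ^ 'd"
  have w: "tensor3 y \<bullet> w x = (y \<bullet> x) * ((y \<bullet> x)\<^sup>2 - B * (y \<bullet> y))" for x y :: "real ^ 'd"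
  proof -
    have "tensor3 y \<bullet> w x = (y \<bullet> x) * (y \<bullet> x)\<^sup>2
        - B * (\<Sum>b\<in>Basis. (y \<bullet> x) * ((y \<bullet> b) * (y \<bullet> b)))"
      by (simp add: w_def tensor3_def inner_diff_right inner_sum_right inner_tensor power2_eq_square)
    also have "(\<Sum>b\<in>Basis. (y \<bullet> x) * ((y \<bullet> b) * (y \<bullet> b))) = (y \<bullet> x) * (y \<bullet> y)"
      by (simp add: euclidean_inner[of y y] sum_distrib_left)
    finally show ?thesis
      by (simp add: algebra_simps)
  qed
  have "card \<Phi> \<le> card ((symmetric_basis :: 'd multiset \<Rightarrow> _) ` multisets_of_size UNIV 3)"
    \<comment> \<open>The diagonal pairing is \<open>1 - B\<close>; off the diagonal one of the two
      factors vanishes.\<close>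
    by (rule card_le_if_biorthogonal[where v = tensor3 and w = w])
      (use fin unit angle \<open>B \<noteq> 1\<close> tensor3_in_span in \<open>fastforce simp: w finite_multisets_of_size\<close>)+
  also have "\<dots> \<le> card (multisets_of_size (UNIV :: 'd set) 3)"
    by (rule card_image_le) (simp add: finite_multisets_of_size)
  also have "\<dots> = (CARD('d) + 2) choose 3"
    by (simp add: card_multisets_of_size)
  finally show ?thesis .
qed

lemma real_choose_3: "real ((m + 2) choose 3) = real m * (real m + 1) * (real m + 2) / 6"
proof (induction m)
  case (Suc m)
  have "Suc m + 2 choose 3 = (m + 2 choose 2) + (m + 2 choose 3)"
    by (simp add: numeral_3_eq_3 numeral_2_eq_2)
  moreover have "real (m + 2 choose 2) = (real m + 2) * (real m + 1) / 2"
    by (simp add: choose_two real_of_nat_div algebra_simps)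
  ultimately show ?case
    using Suc by (simp add: algebra_simps)
qed (simp add: numeral_3_eq_3)

subsection \<open>The strongly regular graph\<close>

lemma sum_two_valued:
  fixes f :: "'a \<Rightarrow> real"
  assumes "finite A" and "\<And>z. z \<in> A \<Longrightarrow> f z = 0 \<or> f z = c"
  shows "\<exists>k :: nat. sum f A = real k * c"
proof
  have "sum f A = (\<Sum>z\<in>A. if f z = c then c else 0)"
    using assms(2) by (intro sum.cong) auto
  also have "\<dots> = real (card {z \<in> A. f z = c}) * c"
    using assms(1) by (simp flip: sum.inter_filter)
  finally show "sum f A = real (card {z \<in> A. f z = c}) * c" .
qed

text \<open>
  Non-orthogonality defines a graph on \<open>\<Phi>\<close> of degree \<open>k\<close>, in which adjacent and non-adjacent points
  have \<open>l\<close> and \<open>m\<close> common neighbours.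
\<close>

lemma strongly_regular_parameters:
  fixes \<Phi> :: "(real ^ 'd) set" and B :: real
  defines "d \<equiv> real CARD('d)" and "n \<equiv> real (card \<Phi>)"
  defines "K \<equiv> n / (d * (d + 2))"
  assumes fin: "finite \<Phi>" and unit: "\<And>x. x \<in> \<Phi> \<Longrightarrow> x \<bullet> x = 1"
    and angle: "\<And>x y. x \<in> \<Phi> \<Longrightarrow> y \<in> \<Phi> \<Longrightarrow> x \<noteq> y \<Longrightarrow> (x \<bullet> y)\<^sup>2 = 0 \<or> (x \<bullet> y)\<^sup>2 = B"
    and B: "B * ((d + 2) * (n - d)) = 3 * n - d * (d + 2)"
    and d: "d > 1" and n: "n > d * (d + 1) / 2"
    and design: "(\<Sum>x\<in>\<Phi>. harmonic2 x) = 0" "(\<Sum>x\<in>\<Phi>. harmonic4 x) = 0"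
  obtains k l m :: nat where "3 * K = 1 + k * B\<^sup>2" and "K * (1 + 2 * B) = 2 * B + l * B\<^sup>2"
    and "K = m * B\<^sup>2"
proof -
  note mixed = design4_mixed_moment[OF design, folded d_def n_def, folded K_def]
  have "d * (d + 1) / 2 > d"
    using d by (simp add: algebra_simps)
  then have "n > d"
    using n by linarith
  then have "card \<Phi> \<noteq> 0"
    using d by (auto simp: n_def)
  then obtain x where x: "x \<in> \<Phi>"
    by fastforce
  have "\<exists>k :: nat. (\<Sum>z\<in>\<Phi> - {x}. (z \<bullet> x)\<^sup>2 * (z \<bullet> x)\<^sup>2) = k * B\<^sup>2"
    using fin angle x by (intro sum_two_valued) (force simp: power2_eq_square)+
  then obtain k :: nat where "(\<Sum>z\<in>\<Phi> - {x}. (z \<bullet> x)\<^sup>2 * (z \<bullet> x)\<^sup>2) = k * B\<^sup>2"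
    by blast
  then have k: "3 * K = 1 + k * B\<^sup>2"
    using mixed[of x x] by (simp only: sum.remove[OF fin x] unit x) simp
  have second_moment: "1 + (\<Sum>z\<in>\<Phi> - {x}. (z \<bullet> x)\<^sup>2) = n / d"
    using design2_moment[OF design(1), of x] by (simp add: sum.remove[OF fin x] unit x d_def n_def)
  \<comment> \<open>In the mixed moment, \<open>z = x\<close> and \<open>z = y\<close> each
    contribute \<open>(x \<bullet> y)\<^sup>2\<close>; every common neighbour contributes
    \<open>B\<^sup>2\<close>.\<close>
  have common: "\<exists>j :: nat. K * (1 + 2 * (x \<bullet> y)\<^sup>2) = 2 * (x \<bullet> y)\<^sup>2 + j * B\<^sup>2"
    if y: "y \<in> \<Phi>" "y \<noteq> x" for y
  proof -
    have fin': "finite (\<Phi> - {x})" and y': "y \<in> \<Phi> - {x}"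
      using fin y by auto
    have "\<exists>j :: nat. (\<Sum>z\<in>\<Phi> - {x} - {y}. (z \<bullet> x)\<^sup>2 * (z \<bullet> y)\<^sup>2) = j * B\<^sup>2"
    proof (rule sum_two_valued)
      fix z
      assume "z \<in> \<Phi> - {x} - {y}"
      then show "(z \<bullet> x)\<^sup>2 * (z \<bullet> y)\<^sup>2 = 0 \<or> (z \<bullet> x)\<^sup>2 * (z \<bullet> y)\<^sup>2 = B\<^sup>2"
        using angle[of z x] angle[of z y] x y by (auto simp: power2_eq_square[of B])
    qed (use fin in simp)
    then obtain j :: nat where "(\<Sum>z\<in>\<Phi> - {x} - {y}. (z \<bullet> x)\<^sup>2 * (z \<bullet> y)\<^sup>2) = j * B\<^sup>2"
      by blast
    then have "(\<Sum>z\<in>\<Phi>. (z \<bullet> x)\<^sup>2 * (z \<bullet> y)\<^sup>2) = 2 * (x \<bullet> y)\<^sup>2 + j * B\<^sup>2"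
      by (simp add: sum.remove[OF fin x] sum.remove[OF fin' y'] unit x y inner_commute[of y x])
    then show ?thesis
      using mixed[of x y] by (auto simp: unit x y)
  qed
  have "\<exists>y\<in>\<Phi> - {x}. (x \<bullet> y)\<^sup>2 \<noteq> 0"
  proof (rule ccontr)
    assume "\<not> ?thesis"
    then have "(\<Sum>z\<in>\<Phi> - {x}. (z \<bullet> x)\<^sup>2) = 0"
      by (intro sum.neutral) (auto simp: inner_commute)
    then show False
      using second_moment \<open>n > d\<close> d by simp
  qed
  then obtain y where "y \<in> \<Phi>" "y \<noteq> x" "(x \<bullet> y)\<^sup>2 = B"
    using angle x by blast
  with common obtain l :: nat where l: "K * (1 + 2 * B) = 2 * B + l * B\<^sup>2"
    by metis
  \<comment> \<open>If \<open>x\<close> made the same angle with all other points, the second moment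
    would force \<open>n = d * (d + 1) / 2\<close>.\<close>
  have "\<exists>y\<in>\<Phi> - {x}. (x \<bullet> y)\<^sup>2 \<noteq> B"
  proof (rule ccontr)
    assume "\<not> ?thesis"
    then have "(\<Sum>z\<in>\<Phi> - {x}. (z \<bullet> x)\<^sup>2) = (\<Sum>z\<in>\<Phi> - {x}. B)"
      by (intro sum.cong) (auto simp: inner_commute)
    also have "\<dots> = (n - 1) * B"
      by (simp only: sum_constant n_def card.remove[OF fin x] of_nat_Suc) simp
    finally have "1 + (n - 1) * B = n / d"
      using second_moment by simp
    then have "(n - 1) * B * d = n - d"
      using d by (simp add: field_simps)
    then have "(n - d) * ((d + 2) * (n - d)) = d * (n - 1) * (B * ((d + 2) * (n - d)))"
      by (metis (no_types) mult.assoc mult.commute)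
    then have "(n * (d - 1)) * (2 * n - d * (d + 1)) = 0"
      unfolding B by (simp add: algebra_simps)
    then show False
      using d n \<open>n > d\<close> by simp
  qed
  then obtain y where "y \<in> \<Phi>" "y \<noteq> x" "(x \<bullet> y)\<^sup>2 = 0"
    using angle x by blast
  with common obtain m :: nat where "K = m * B\<^sup>2"
    by fastforce
  with k l show thesis
    using that by blast
qed

text \<open>
  The numbers \<open>- 1 / B\<close> and \<open>(2 * K - 1) / B\<close> are the two non-principal eigenvalues of that graph,
  that is, the roots of \<open>X\<^sup>2 - (l - m) * X - (k - m)\<close>.
\<close>

lemma srg_eigenvalues_integral:
  fixes K B :: real and k l m :: nat
  assumes "B \<in> \<rat>" and "B \<noteq> 0" and "3 * K = 1 + k * B\<^sup>2"
    and "K * (1 + 2 * B) = 2 * B + l * B\<^sup>2" and "K = m * B\<^sup>2"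
  shows "1 / B \<in> \<int>" and "(2 * K - 1) / B \<in> \<int>"
proof -
  have lm: "(real l - real m) * B = 2 * K - 2"
  proof -
    have "((real l - real m) * B) * B = (2 * K - 2) * B"
      using assms by (simp add: algebra_simps power2_eq_square)
    then show ?thesis
      using \<open>B \<noteq> 0\<close> by simp
  qed
  \<comment> \<open>The eigenvalue polynomial with \<open>X\<close> replaced by \<open>- X\<close>,
    so that the root is \<open>1 / B\<close>.\<close>
  define p where "p = [:real m - real k, real l - real m, 1:]"
  have "poly p (1 / B) * B\<^sup>2 = (real m - real k) * B\<^sup>2 + (real l - real m) * B + 1"
    using \<open>B \<noteq> 0\<close> by (simp add: p_def field_simps power2_eq_square)
  also have "\<dots> = 0"
    using assms lm by (simp add: algebra_simps)
  finally have "poly p (1 / B) = 0"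
    using \<open>B \<noteq> 0\<close> by simp
  moreover have "coeff p i \<in> \<int>" for i
    by (simp add: p_def coeff_pCons split: nat.split)
  ultimately have "algebraic_int (1 / B)"
    by (intro algebraic_int.intros[of p]) (simp_all add: p_def)
  then show int: "1 / B \<in> \<int>"
    using assms(1) by (intro rational_algebraic_int_is_int) auto
  \<comment> \<open>The two eigenvalues sum to the integer \<open>l - m\<close>.\<close>
  have "(2 * K - 1) / B = real l - real m + 1 / B"
    using lm \<open>B \<noteq> 0\<close> by (simp add: field_simps)
  then show "(2 * K - 1) / B \<in> \<int>"
    using int by simp
qed

text \<open>
  For such \<open>n\<close> the second eigenvalue lies strictly between -1 and 1, so it is 0.
\<close>

lemma levenstein_gap:
  fixes d n K B :: real
  assumes B: "B * ((d + 2) * (n - d)) = 3 * n - d * (d + 2)" and "B > 0"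
    and "d \<ge> 3" and n: "n > d * (d + 1) / 2" "n < d * (d + 3) / 2"
    and K: "K = n / (d * (d + 2))" and int: "(2 * K - 1) / B \<in> \<int>"
  shows "n = d * (d + 2) / 2"
proof -
  have "d > 1"
    using \<open>d \<ge> 3\<close> by simp
  then have "d * (d + 1) / 2 > d"
    by (simp add: algebra_simps)
  then have nd: "n > d"
    using n by linarith
  have pos: "(d + 2) * (n - d) > 0"
    using nd \<open>d > 1\<close> by simp
  have B_eq: "B = (3 * n - d * (d + 2)) / ((d + 2) * (n - d))"
    using B pos by (simp add: field_simps)
  have "1 / (d + 2) - (1 - 2 * K) = (2 * n - d * (d + 1)) / (d * (d + 2))"
    using \<open>d > 1\<close> unfolding K by (simp add: divide_simps) (simp add: algebra_simps)
  also have "\<dots> > 0"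
    using n \<open>d > 1\<close> by simp
  \<comment> \<open>The value \<open>1 / (d + 2)\<close> separates \<open>1 - 2 * K\<close> from
    \<open>B\<close>: both comparisons reduce to \<open>n > d * (d + 1) / 2\<close>.\<close>
  finally have "1 - 2 * K < 1 / (d + 2)"
    by simp
  moreover have "1 / (d + 2) < B"
    using pos nd n \<open>d > 1\<close> unfolding B_eq by (simp add: divide_simps) (simp add: algebra_simps)
  ultimately have "(2 * K - 1) / B > -1"
    using \<open>B > 0\<close> by (simp add: field_simps)
  moreover have "(2 * K - 1) / B < 1"
  proof -
    \<comment> \<open>After clearing denominators, \<open>2 * K - 1 < B\<close> is quadratic in
      \<open>n\<close>. It splits into this product and terms that are nonpositive for
      \<open>d \<ge> 3\<close>.\<close>
    have "(n - d * (d + 1) / 2) * (n - d * (d + 3) / 2) < 0"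
      using n by (simp add: mult_pos_neg)
    moreover have "n * (d * (d - 3)) \<le> d * (d + 3) / 2 * (d * (d - 3))"
      using n \<open>d \<ge> 3\<close> by (intro mult_right_mono) auto
    moreover have "(2 * n - d * (d + 2)) * (n - d) - d * (3 * n - d * (d + 2))
        = 2 * ((n - d * (d + 1) / 2) * (n - d * (d + 3) / 2))
          + (n * (d * (d - 3)) - d * (d + 3) / 2 * (d * (d - 3))) - 2 * (d * d)"
      by (simp add: field_simps)
    ultimately have "(2 * n - d * (d + 2)) * (n - d) < d * (3 * n - d * (d + 2))"
      using zero_le_square[of d] by linarith
    then have "2 * K - 1 < B"
      using pos nd \<open>d > 1\<close> unfolding B_eq K by (simp add: divide_simps) (simp add: algebra_simps)
    then show ?thesis
      using \<open>B > 0\<close> by simp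
  qed
  ultimately have "(2 * K - 1) / B = 0"
    using int by (intro Ints_nonzero_abs_less1) auto
  then show ?thesis
    using \<open>B > 0\<close> \<open>d > 1\<close> unfolding K by (simp add: field_simps)
qed

section \<open>Parameters of a packing and the resulting bounds on its size\<close>

lemma abs_inner_le_coherence:
  assumes "finite \<Phi>" and "x \<in> \<Phi>" and "y \<in> \<Phi>" and "x \<noteq> y"
  shows "\<bar>x \<bullet> y\<bar> \<le> coherence \<Phi>"
proof -
  have "{\<bar>x \<bullet> y\<bar> | x y. x \<in> \<Phi> \<and> y \<in> \<Phi> \<and> x \<noteq> y} \<subseteq> (\<lambda>(x, y). \<bar>x \<bullet> y\<bar>) ` (\<Phi> \<times> \<Phi>)"
    by auto
  then have "finite {\<bar>x \<bullet> y\<bar> | x y. x \<in> \<Phi> \<and> y \<in> \<Phi> \<and> x \<noteq> y}"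
    by (rule finite_subset) (simp add: \<open>finite \<Phi>\<close>)
  then show ?thesis
    using assms unfolding coherence_def by (intro Max_ge) auto
qed

lemma levenstein_packing_parameters:
  fixes \<Phi> :: "(real ^ 'd) set"
  defines "d \<equiv> real CARD('d)"
  assumes packing: "levenstein_equality_packing n \<Phi>" and d: "d > 1"
  obtains B where "B > 0" and "B * ((d + 2) * (real n - d)) = 3 * real n - d * (d + 2)"
    and "1 / B \<in> \<int>" and "(2 * (real n / (d * (d + 2))) - 1) / B \<in> \<int>"
    and "real n \<le> d * (d + 1) * (d + 2) / 6"
proof -
  have fin: "finite \<Phi>" and n: "card \<Phi> = n" "real n > d * (d + 1) / 2"
    and unit: "\<And>x. x \<in> \<Phi> \<Longrightarrow> x \<bullet> x = 1"
    and coh: "coherence \<Phi> = levenstein_bound CARD('d) n"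
    using packing by (auto simp: levenstein_equality_packing_def d_def norm_eq_1)
  define B where "B = (3 * real n - d * (d + 2)) / ((d + 2) * (real n - d))"
  have "d < d * (d + 1) / 2" "d * (d + 2) < 3 * (d * (d + 1) / 2)"
    using d by (simp_all add: field_simps)
  then have nd: "real n > d" "3 * real n > d * (d + 2)"
    using n(2) by linarith+
  then have "B > 0" and B: "B * ((d + 2) * (real n - d)) = 3 * real n - d * (d + 2)"
    using d by (simp_all add: B_def)
  \<comment> \<open>This yields \<open>B < 3 / (d + 2)\<close>, which ensures both the positive
    degree-2 coefficient in the linear programming bound and \<open>B \<noteq> 1\<close>.\<close>
  have "B * (d + 2) * (real n - d) < 3 * (real n - d)"
  proof -
    have "3 * d < d * (d + 2)"
      using d by (simp add: algebra_simps)
    then show ?thesis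
      using B by (simp only: mult.assoc) (simp add: right_diff_distrib)
  qed
  then have "B * (d + 2) < 3"
    by (rule mult_right_less_imp_less) (use nd in simp)
  then have "B < 3 / (d + 2)"
    using d by (simp add: pos_less_divide_eq)
  moreover have "3 / (d + 2) \<le> 6 / (d + 4)" "3 / (d + 2) < 1"
    using d by (simp_all add: field_simps)
  ultimately have B_less: "B < 6 / (d + 4)" and "B \<noteq> 1"
    by linarith+
  have le: "(x \<bullet> y)\<^sup>2 \<le> B" if "x \<in> \<Phi>" "y \<in> \<Phi>" "x \<noteq> y" for x y
  proof -
    have "\<bar>x \<bullet> y\<bar> \<le> sqrt B"
      using abs_inner_le_coherence[OF fin that] coh
      by (simp add: levenstein_bound_def B_def d_def)
    then have "\<bar>x \<bullet> y\<bar>\<^sup>2 \<le> (sqrt B)\<^sup>2"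
      by (intro power_mono) auto
    then show ?thesis
      using \<open>B > 0\<close> by simp
  qed
  note equality_case = levenstein_equality_case[OF fin _ _ B[unfolded d_def, folded n(1)] B_less[unfolded d_def]]
  have equality: "(\<Sum>x\<in>\<Phi>. harmonic2 x) = 0" "(\<Sum>x\<in>\<Phi>. harmonic4 x) = 0"
    by (rule equality_case; use unit le in blast)+
  have angle: "(x \<bullet> y)\<^sup>2 = 0 \<or> (x \<bullet> y)\<^sup>2 = B" if "x \<in> \<Phi>" "y \<in> \<Phi>" "x \<noteq> y" for x y
    by (rule equality_case) (use unit le that in blast)+
  obtain k l m :: nat where
    "3 * (real n / (d * (d + 2))) = 1 + k * B\<^sup>2"
    "real n / (d * (d + 2)) * (1 + 2 * B) = 2 * B + l * B\<^sup>2"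
    "real n / (d * (d + 2)) = m * B\<^sup>2"
    using strongly_regular_parameters[OF fin _ _ B[unfolded d_def, folded n(1)] d[unfolded d_def]
        n(2)[unfolded d_def, folded n(1)] equality] unit angle
    unfolding d_def n(1) by blast
  moreover have "B \<in> \<rat>"
    by (simp add: B_def d_def)
  ultimately have "1 / B \<in> \<int>" "(2 * (real n / (d * (d + 2))) - 1) / B \<in> \<int>"
    using srg_eigenvalues_integral \<open>B > 0\<close> by (metis less_irrefl)+
  moreover have "n \<le> (CARD('d) + 2) choose 3"
    using absolute_bound[OF fin unit \<open>B \<noteq> 1\<close> angle] n(1) by simp
  then have "real n \<le> d * (d + 1) * (d + 2) / 6"
    by (metis d_def of_nat_le_iff real_choose_3)
  ultimately show thesis
    using that \<open>B > 0\<close> B by blast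
qed

theorem theorem1p5:
  fixes \<Phi> :: "(real ^ 'd) set" and d n :: nat
  assumes "CARD('d) = d" and "d \<ge> 4"
    and "levenstein_equality_packing n \<Phi>"
  shows "(real n = real d * (real d + 2) / 2 \<or>
          real n \<in> {real d * (real d + 2) * (real d - 1 + \<alpha>) / (3 * \<alpha>) | \<alpha>.
                      \<alpha> \<in> {2 .. 2 * (real d - 1) * (real d + 2) / (real d + 5)} \<inter> \<int>} \<inter> \<int>)
       \<and> (real n \<notin> {real d * (real d + 2) / 2, real d * (real d + 1) * (real d + 2) / 6} \<longrightarrow>
            real d * (real d + 3) / 2 \<le> real n \<and> real n \<le> real d * (real d + 2)^2 / 9)"
proof (cases "real n = real d * (real d + 2) / 2")
  case False
  define D N where "D = real d" and "N = real n"
  have D: "D \<ge> 4"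
    using assms(2) by (simp add: D_def)
  have n: "N > D * (D + 1) / 2"
    using assms(1,3) by (simp add: levenstein_equality_packing_def D_def N_def)
  obtain B where "B > 0" and B: "B * ((D + 2) * (N - D)) = 3 * N - D * (D + 2)"
    and int: "1 / B \<in> \<int>" "(2 * (N / (D * (D + 2))) - 1) / B \<in> \<int>"
    and upper: "N \<le> D * (D + 1) * (D + 2) / 6"
    using levenstein_packing_parameters[OF assms(3)] D unfolding assms(1) D_def N_def by auto
  have lower: "D * (D + 3) / 2 \<le> N"
    using levenstein_gap[OF B \<open>B > 0\<close> _ n _ refl int(2)] D False
    by (force simp: D_def N_def)
  define \<alpha> where "\<alpha> = 3 / B - D - 2"
  have "3 / B = 3 * (1 / B)"
    by simp
  then have "3 / B \<in> \<int>"
    using int(1) by (metis Ints_mult Ints_numeral)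
  then have \<alpha>_int: "\<alpha> \<in> \<int>"
    by (simp add: \<alpha>_def D_def)
  have "D * (D + 2) < 3 * (D * (D + 1) / 2)"
    using D by (simp add: field_simps)
  then have pos: "3 * N - D * (D + 2) > 0"
    using n by linarith
  have "3 / B * (3 * N - D * (D + 2)) = 3 * ((D + 2) * (N - D))"
    using \<open>B > 0\<close> by (simp flip: B)
  then have \<alpha>: "\<alpha> * (3 * N - D * (D + 2)) = D * (D + 2) * (D - 1)"
    by (simp add: \<alpha>_def algebra_simps)
  then have "\<alpha> > 0"
    using pos D by (metis (no_types) add_pos_pos diff_gt_0_iff_gt less_le_trans mult_pos_pos
        one_less_numeral_iff semiring_norm(76) zero_less_mult_pos2 zero_less_numeral)
  have N: "N = D * (D + 2) * (D - 1 + \<alpha>) / (3 * \<alpha>)"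
    using \<alpha> \<open>\<alpha> > 0\<close> by (simp add: field_simps)
  have \<alpha>_eq: "\<alpha> = D * (D + 2) * (D - 1) / (3 * N - D * (D + 2))"
    using \<alpha> pos by (simp add: field_simps)
  have "\<alpha> \<ge> 2"
  proof -
    have "2 * (3 * N - D * (D + 2)) \<le> D * (D + 2) * (D - 1)"
      using upper by (simp add: algebra_simps)
    then show ?thesis
      using pos by (simp add: \<alpha>_eq pos_le_divide_eq)
  qed
  \<comment> \<open>\<open>\<alpha>\<close> decreases as \<open>N\<close> grows, so its upper bound
    is its value at \<open>N = D * (D + 3) / 2\<close>.\<close>
  moreover have "\<alpha> \<le> 2 * (D - 1) * (D + 2) / (D + 5)"
  proof -
    have "D * (D + 5) / 2 = 3 * (D * (D + 3) / 2) - D * (D + 2)"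
      by (simp add: field_simps)
    then have "D * (D + 5) / 2 \<le> 3 * N - D * (D + 2)"
      using lower by linarith
    then have "\<alpha> * (D * (D + 5) / 2) \<le> \<alpha> * (3 * N - D * (D + 2))"
      using \<open>\<alpha> > 0\<close> by (intro mult_left_mono) simp_all
    moreover have "D * (\<alpha> * (D + 5)) = 2 * (\<alpha> * (D * (D + 5) / 2))"
      "D * (2 * (D - 1) * (D + 2)) = 2 * (D * (D + 2) * (D - 1))"
      by simp_all
    ultimately have "D * (\<alpha> * (D + 5)) \<le> D * (2 * (D - 1) * (D + 2))"
      unfolding \<alpha> by linarith
    then show ?thesis
      using D by (simp add: pos_le_divide_eq)
  qed
  moreover have "N \<le> D * (D + 2)\<^sup>2 / 9" if "N \<noteq> D * (D + 1) * (D + 2) / 6"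
  proof -
    \<comment> \<open>\<open>\<alpha> = 2\<close> corresponds exactly to the excluded size; by
      integrality the next case is \<open>\<alpha> = 3\<close>, where
      \<open>N = D * (D + 2)\<^sup>2 / 9\<close>.\<close>
    have "\<alpha> \<noteq> 2"
      using that N by (auto simp: algebra_simps)
    then have "\<alpha> \<ge> 3"
      using \<open>\<alpha> \<ge> 2\<close> \<alpha>_int by (auto elim!: Ints_cases)
    then have "3 * (3 * N - D * (D + 2)) \<le> D * (D + 2) * (D - 1)"
      using pos mult_right_mono[of 3 \<alpha> "3 * N - D * (D + 2)"] unfolding \<alpha> by simp
    then show ?thesis
      by (simp add: power2_eq_square algebra_simps)
  qed
  moreover have "N \<in> \<int>"
    by (simp add: N_def)
  moreover have "\<exists>\<alpha>. N = D * (D + 2) * (D - 1 + \<alpha>) / (3 * \<alpha>)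
      \<and> \<alpha> \<in> {2 .. 2 * (D - 1) * (D + 2) / (D + 5)} \<inter> \<int>"
    using N \<alpha>_int calculation(1,2) by (intro exI[of _ \<alpha>]) simp
  ultimately show ?thesis
    using lower unfolding D_def N_def by auto
qed simp

end
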